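(* Let $X$ be a normed space and let $I, K$ be ideals on $\mathbb{N}$. Suppose that every weak $I$-Cauchy sequence in $X$ is weak $I^K$-Cauchy. Then the condition AP$(I,K)$ holds.
   Context: $\mathbb{N}$ is the set of positive integers; $X^*$ is the (topological) dual of the normed linear space $X$. An ideal on a set $S$ is a class $I\subset 2^S$ (with $\emptyset\in I$) such that $A,B\in I$ implies $A\cup B\in I$, and $A\in I$, $B\subset A$ implies $B\in I$. For an ideal $I$ on $\mathbb{N}$, $F(I)=\{A\subset\mathbb{N}:\mathbb{N}\setminus A\in I\}$. Weak $I$-Cauchy: $\{x_n\}$ in $X$ is weak $I$-Cauchy if for each $\epsilon>0$ and $f\in X^*$ there exists a positive integer $N=N(\epsilon,f)$ such that $\{n\in\mathbb{N}:|f(x_n)-f(x_N)|\ge\epsilon\}\in I$. Weak $I^K$-Cauchy: $\{x_n\}$ in $X$ is weak $I^K$-Cauchy if there exists a set $M\in F(I)$ such that $\{x_n\}_{n\in M}$ is weak $K|_M$-Cauchy, where $K|_M=\{A\cap M:A\in K\}$ (an ideal on $M$); that is, for each $\epsilon>0$ and $f\in X^*$ there is $N\in M$ with $\{n\in M:|f(x_n)-f(x_N)|\ge\epsilon\}\in K|_M$. The set $M$ does not depend on $f$ or $\epsilon$. AP$(I,K)$: for every sequence $\{A_n\}_{n\in\mathbb{N}}$ of pairwise disjoint sets belonging to $I$ there exists a sequence $\{B_n\}_{n\in\mathbb{N}}$ of sets belonging to $I$ such that $A_n\bigtriangleup B_n\in K$ for each $n$ and $\bigcup_{n\in\mathbb{N}}B_n\in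 I$. (Equivalently: for every sequence $\{A_i\}_{i\in\mathbb{N}}$ of sets from $I$ there is $A\in I$ with $A_i\setminus A\in K$ for all $i$.)
   Formalization: The normed space X (over the reals) is assumed nonzero: for X = {0} every sequence is weak I^K-Cauchy, yet AP(I,K) fails for K the finite sets and I generated by the finite sets and the blocks of a partition of N into infinitely many infinite sets. *)

theory Defs
  imports "HOL-Analysis.Analysis"
begin

abbreviation posnat :: "nat set" where
  "posnat \<equiv> {1..}"

text \<open>Ideals are not required to be proper or to contain the finite sets.\<close>

definition ideal_on :: "'s set \<Rightarrow> 's set set \<Rightarrow> bool" where
  "ideal_on S I \<longleftrightarrow>
     I \<subseteq> Pow S \<and> {} \<in> I \<and>
     (\<forall>A\<in>I. \<forall>B\<in>I. A \<union> B \<in> I) \<and>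
     (\<forall>A\<in>I. \<forall>B. B \<subseteq> A \<longrightarrow> B \<in> I)"

definition dual_filter :: "nat set set \<Rightarrow> nat set set" where
  "dual_filter I = {A. A \<subseteq> posnat \<and> posnat - A \<in> I}"

definition ideal_trace :: "'s set set \<Rightarrow> 's set \<Rightarrow> 's set set" where
  "ideal_trace K M = {A \<inter> M | A. A \<in> K}"

text \<open>Sequences are functions on \<^typ>\<open>nat\<close> of which only the values on the index set
  \<open>M\<close> matter; \<open>J\<close> is meant to be an ideal on \<open>M\<close>.\<close>

definition weak_Cauchy_on ::
    "nat set \<Rightarrow> nat set set \<Rightarrow> (nat \<Rightarrow> 'a::real_normed_vector) \<Rightarrow> bool" where
  "weak_Cauchy_on M J x \<longleftrightarrow>
     (\<forall>\<epsilon>>0. \<forall>f::'a \<Rightarrow> real. bounded_linear f \<longrightarrow>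
        (\<exists>N\<in>M. {n\<in>M. \<bar>f (x n) - f (x N)\<bar> \<ge> \<epsilon>} \<in> J))"

definition weak_I_Cauchy :: "nat set set \<Rightarrow> (nat \<Rightarrow> 'a::real_normed_vector) \<Rightarrow> bool" where
  "weak_I_Cauchy I x \<longleftrightarrow> weak_Cauchy_on posnat I x"

definition weak_IK_Cauchy ::
    "nat set set \<Rightarrow> nat set set \<Rightarrow> (nat \<Rightarrow> 'a::real_normed_vector) \<Rightarrow> bool" where
  "weak_IK_Cauchy I K x \<longleftrightarrow>
     (\<exists>M\<in>dual_filter I. weak_Cauchy_on M (ideal_trace K M) x)"

definition AP :: "nat set set \<Rightarrow> nat set set \<Rightarrow> bool" where
  "AP I K \<longleftrightarrow>
     (\<forall>A :: nat \<Rightarrow> nat set.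
        (\<forall>n\<in>posnat. A n \<in> I) \<and> disjoint_family_on A posnat \<longrightarrow>
        (\<exists>B :: nat \<Rightarrow> nat set.
           (\<forall>n\<in>posnat. B n \<in> I \<and> (A n - B n) \<union> (B n - A n) \<in> K) \<and>
           (\<Union>n\<in>posnat. B n) \<in> I))"

end

theory Submission
  imports Defs
begin

text \<open>
  Given pairwise disjoint sets \<open>A n \<in> I\<close>, put the vector \<open>v /\<^sub>R n\<close> (for a fixed \<open>v \<noteq> 0\<close>) on \<open>A n\<close>
  and \<open>0\<close> elsewhere. For every functional \<open>f\<close> only finitely many of the values \<open>f v / n\<close> are far
  from \<open>0\<close>, so the sequence is weakly \<open>I\<close>-convergent to \<open>0\<close>, and in particular weak \<open>I\<close>-Cauchy
  (lemma \<open>weak_I_Cauchy_if_small_off_ideal\<close>).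
  By hypothesis it is then weak \<open>K\<close>-Cauchy along some \<open>M \<in> F(I)\<close>. Apply this to a functional with
  \<open>f v \<noteq> 0\<close>. The value \<open>f v / n\<close> is isolated among all values of the sequence, hence \<open>K\<close> contains
  \<open>M \<inter> A n\<close> or \<open>M - A n\<close>, according to whether the reference index \<open>N\<close> lies outside or inside \<open>A n\<close>
  (lemma \<open>Cauchy_isolated_value_dichotomy\<close>). The second alternative with \<open>n = m\<close> forces the first
  one for every \<open>n \<noteq> m\<close>, by disjointness. So the sets \<open>B n = A n - M\<close>, except that \<open>B m = A m\<close> for the
  possible exceptional \<open>m\<close>, are the required modification: their union lies in
  \<open>(\<nat> - M) \<union> A m \<in> I\<close>.

  The existence of \<open>f\<close> with \<open>f v \<noteq> 0\<close> is the Hahn--Banach theorem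
  (lemma \<open>exists_functional_nonzero_at\<close>). It is derived without
  extending partial functions: Zorn's lemma is applied to sublinear functionals on the whole space,
  ordered pointwise, and a minimal sublinear functional is linear.
\<close>

section \<open>Minimal sublinear functionals\<close>

text \<open>Homogeneity is only required as an inequality, which is easier to verify for infima; equality
  follows by rescaling with \<open>inverse c\<close>, as in \<open>sublinear_scaleR\<close>.\<close>

definition sublinear :: "('a::real_vector \<Rightarrow> real) \<Rightarrow> bool" where
  "sublinear p \<longleftrightarrow>
     (\<forall>x y. p (x + y) \<le> p x + p y) \<and> (\<forall>c x. c \<ge> 0 \<longrightarrow> p (c *\<^sub>R x) \<le> c * p x)"

lemma sublinear_add: "sublinear p \<Longrightarrow> p (x + y) \<le> p x + p y"
  by (simp add: sublinear_def)

lemma sublinear_scaleR_le: "sublinear p \<Longrightarrow> c \<ge> 0 \<Longrightarrow> p (c *\<^sub>R x) \<le> c * p x"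
  by (simp add: sublinear_def)

lemma sublinear_zero:
  assumes "sublinear p" shows "p 0 = 0"
  using sublinear_add[OF assms, of 0 0] sublinear_scaleR_le[OF assms, of 0 0] by simp

lemma sublinear_scaleR:
  assumes p: "sublinear p" and "c \<ge> 0"
  shows "p (c *\<^sub>R x) = c * p x"
proof (cases "c = 0")
  case True
  then show ?thesis by (simp add: sublinear_zero[OF p])
next
  case False
  with \<open>c \<ge> 0\<close> have "c > 0" by simp
  have "p (inverse c *\<^sub>R (c *\<^sub>R x)) \<le> inverse c * p (c *\<^sub>R x)"
    using \<open>c > 0\<close> by (intro sublinear_scaleR_le p) simp
  then have "c * p x \<le> p (c *\<^sub>R x)"
    using \<open>c > 0\<close> by (simp add: field_simps)
  then show ?thesis
    using sublinear_scaleR_le[OF p \<open>c \<ge> 0\<close>, of x] by simp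
qed

lemma sublinear_minus:
  assumes "sublinear p" shows "- p (- x) \<le> p x"
  using sublinear_add[OF assms, of x "- x"] sublinear_zero[OF assms] by simp

text \<open>The members of the family need not be sublinear themselves: the two inequalities may pass from
  one member to another. This covers both infima used below, the one over a chain and the one over
  a half-line of translates.\<close>

lemma sublinear_INF:
  fixes g :: "'i \<Rightarrow> 'a::real_vector \<Rightarrow> real"
  assumes ne: "S \<noteq> {}"
    and bdd: "\<And>x. bdd_below ((\<lambda>i. g i x) ` S)"
    and add: "\<And>i j x y. i \<in> S \<Longrightarrow> j \<in> S \<Longrightarrow> \<exists>k\<in>S. g k (x + y) \<le> g i x + g j y"
    and scale: "\<And>i c x. i \<in> S \<Longrightarrow> c \<ge> 0 \<Longrightarrow> \<exists>k\<in>S. g k (c *\<^sub>R x) \<le> c * g i x"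
  shows "sublinear (\<lambda>x. INF i\<in>S. g i x)"
proof -
  let ?u = "\<lambda>x. INF i\<in>S. g i x"
  have lower: "?u x \<le> g i x" if "i \<in> S" for i x
    using that bdd by (intro cINF_lower)
  have "?u (x + y) \<le> ?u x + ?u y" for x y
  proof -
    have *: "?u (x + y) \<le> g i x + g j y" if "i \<in> S" "j \<in> S" for i j
      using add[OF that, of x y] lower by (meson order_trans)
    have "?u (x + y) - g j y \<le> ?u x" if "j \<in> S" for j
      using ne *[OF _ that] by (intro cINF_greatest) (auto simp: algebra_simps)
    then have "?u (x + y) - ?u x \<le> ?u y"
      using ne by (intro cINF_greatest) (auto simp: algebra_simps)
    then show ?thesis by simp
  qed
  moreover have "?u (c *\<^sub>R x) \<le> c * ?u x" if "c \<ge> 0" for c x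
  proof -
    have *: "?u (c *\<^sub>R x) \<le> c * g i x" if "i \<in> S" for i
      using scale[OF that \<open>c \<ge> 0\<close>, of x] lower by (meson order_trans)
    show ?thesis
    proof (cases "c = 0")
      case True
      then show ?thesis using ne * by auto
    next
      case False
      with \<open>c \<ge> 0\<close> have "c > 0" by simp
      then have "?u (c *\<^sub>R x) / c \<le> ?u x"
        using ne * by (intro cINF_greatest) (auto simp: field_simps)
      then show ?thesis using \<open>c > 0\<close> by (simp add: field_simps)
    qed
  qed
  ultimately show ?thesis by (simp add: sublinear_def)
qed

text \<open>Replacing \<open>p x\<close> by the infimum of \<open>p (x + t *\<^sub>R y) - t * p y\<close> over \<open>t \<ge> 0\<close> makes the functional
  smaller and forces it to be odd at \<open>y\<close>; the choice \<open>t = 1\<close> gives the bound at \<open>- y\<close>.\<close>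

lemma sublinear_decrease:
  assumes p: "sublinear p"
  shows "\<exists>q. sublinear q \<and> q \<le> p \<and> q (- y) \<le> - p y"
proof -
  define g where "g t x = p (x + t *\<^sub>R y) - t * p y" for t x
  let ?q = "\<lambda>x. INF t\<in>{0..}. g t x"
  have bdd: "bdd_below ((\<lambda>t. g t x) ` {0..})" for x
  proof (rule bdd_belowI2)
    fix t :: real assume "t \<in> {0..}"
    have "p (t *\<^sub>R y) \<le> p (x + t *\<^sub>R y) + p (- x)"
      using sublinear_add[OF p, of "x + t *\<^sub>R y" "- x"] by simp
    then show "- p (- x) \<le> g t x"
      using sublinear_scaleR[OF p, of t y] \<open>t \<in> {0..}\<close> by (simp add: g_def)
  qed
  have "sublinear ?q"
  proof (rule sublinear_INF)
    show "bdd_below ((\<lambda>t. g t x) ` {0..})" for x by (rule bdd)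
  next
    fix s t :: real and x z assume "s \<in> {0..}" "t \<in> {0..}"
    have "g (s + t) (x + z) \<le> g s x + g t z"
      using sublinear_add[OF p, of "x + s *\<^sub>R y" "z + t *\<^sub>R y"]
      by (simp add: g_def algebra_simps)
    then show "\<exists>k\<in>{0..}. g k (x + z) \<le> g s x + g t z"
      using \<open>s \<in> {0..}\<close> \<open>t \<in> {0..}\<close> by (intro bexI[of _ "s + t"]) auto
  next
    fix t c :: real and x assume "t \<in> {0..}" "c \<ge> 0"
    have "g (c * t) (c *\<^sub>R x) \<le> c * g t x"
      using sublinear_scaleR_le[OF p \<open>c \<ge> 0\<close>, of "x + t *\<^sub>R y"]
      by (simp add: g_def algebra_simps)
    then show "\<exists>k\<in>{0..}. g k (c *\<^sub>R x) \<le> c * g t x"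
      using \<open>t \<in> {0..}\<close> \<open>c \<ge> 0\<close> by (intro bexI[of _ "c * t"]) auto
  qed simp
  moreover have "?q x \<le> p x" for x
    using cINF_lower[OF bdd, of 0 x] by (simp add: g_def)
  moreover have "?q (- y) \<le> - p y"
    using cINF_lower[OF bdd, of 1 "- y"] by (simp add: g_def sublinear_zero[OF p])
  ultimately show ?thesis by (intro exI[of _ ?q]) (auto simp: le_fun_def)
qed

lemma minimal_sublinear_imp_linear:
  assumes f: "sublinear f" and min: "\<And>q. sublinear q \<Longrightarrow> q \<le> f \<Longrightarrow> q = f"
  shows "linear f"
proof -
  have odd: "f (- y) = - f y" for y
  proof -
    obtain q where q: "sublinear q" "q \<le> f" "q (- y) \<le> - f y"
      using sublinear_decrease[OF f] by blast
    then have "f (- y) \<le> - f y" using min by metis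
    with sublinear_minus[OF f, of y] show ?thesis by simp
  qed
  show ?thesis
  proof (rule linearI)
    fix x y
    show "f (x + y) = f x + f y"
      using sublinear_add[OF f, of x y] sublinear_add[OF f, of "x + y" "- y"] odd[of y] by simp
  next
    fix c :: real and x
    show "f (c *\<^sub>R x) = c *\<^sub>R f x"
    proof (cases "c \<ge> 0")
      case True
      then show ?thesis by (simp add: sublinear_scaleR[OF f])
    next
      case False
      then show ?thesis
        using sublinear_scaleR[OF f, of "- c" x] odd[of "c *\<^sub>R x"] by simp
    qed
  qed
qed

text \<open>Zorn's lemma applies because a sublinear functional below \<open>p\<close> is bounded below at \<open>x\<close> by
  \<open>- p (- x)\<close>, so the pointwise infimum of a chain is finite.\<close>

lemma exists_minimal_sublinear:
  fixes p :: "'a::real_vector \<Rightarrow> real"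
  assumes p: "sublinear p"
  shows "\<exists>f. sublinear f \<and> f \<le> p \<and> (\<forall>q. sublinear q \<longrightarrow> q \<le> f \<longrightarrow> q = f)"
proof -
  let ?A = "{q. sublinear q \<and> q \<le> p}"
  let ?P = "\<lambda>q r :: 'a \<Rightarrow> real. r \<le> q"
  have "\<exists>m\<in>?A. \<forall>a\<in>?A. ?P m a \<longrightarrow> a = m"
  proof (rule predicate_Zorn)
    show "partial_order_on ?A (relation_of ?P ?A)"
      by (rule partial_order_on_relation_ofI) auto
  next
    fix C assume "C \<in> Chains (relation_of ?P ?A)"
    then have CA: "q \<in> ?A" and tot: "q \<le> r \<or> r \<le> q" if "q \<in> C" "r \<in> C" for q r
      using that by (auto simp: Chains_def relation_of_def)
    show "\<exists>u\<in>?A. \<forall>a\<in>C. ?P a u"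
    proof (cases "C = {}")
      case True
      then show ?thesis using p by auto
    next
      case False
      let ?u = "\<lambda>x. INF q\<in>C. q x"
      have bdd: "bdd_below ((\<lambda>q. q x) ` C)" for x
      proof (rule bdd_belowI2)
        fix q assume "q \<in> C"
        then have "sublinear q" "q (- x) \<le> p (- x)" using CA by (auto simp: le_fun_def)
        then show "- p (- x) \<le> q x" using sublinear_minus[of q x] by linarith
      qed
      have lower: "?u \<le> q" if "q \<in> C" for q
        using cINF_lower[OF bdd that] by (auto simp: le_fun_def)
      have "sublinear ?u"
      proof (rule sublinear_INF[OF False bdd])
        fix q r x y assume qr: "q \<in> C" "r \<in> C"
        then have sub: "sublinear q" "sublinear r" using CA by auto
        show "\<exists>k\<in>C. k (x + y) \<le> q x + r y"
          using tot[OF qr]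
        proof
          assume "q \<le> r"
          then have "q (x + y) \<le> q x + r y"
            using sublinear_add[OF sub(1), of x y] le_funD[of q r y] by linarith
          with qr show ?thesis by blast
        next
          assume "r \<le> q"
          then have "r (x + y) \<le> q x + r y"
            using sublinear_add[OF sub(2), of x y] le_funD[of r q x] by linarith
          with qr show ?thesis by blast
        qed
      next
        fix q x and c :: real assume "q \<in> C" "c \<ge> 0"
        then show "\<exists>k\<in>C. k (c *\<^sub>R x) \<le> c * q x"
          using CA sublinear_scaleR_le by blast
      qed
      moreover have "?u \<le> p"
        using False lower CA by (metis (no_types, lifting) all_not_in_conv mem_Collect_eq order_trans)
      ultimately show ?thesis using lower by auto
    qed
  qed
  then obtain f where "sublinear f" "f \<le> p" "\<And>q. sublinear q \<Longrightarrow> q \<le> p \<Longrightarrow> q \<le> f \<Longrightarrow> q = f"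
    by auto
  then show ?thesis using order_trans by blast
qed

text \<open>Decreasing the norm at \<open>v\<close> first yields a sublinear \<open>q\<close> with \<open>q (- v) \<le> - norm v < 0\<close>, and
  every functional below \<open>q\<close> inherits both this and the bound by the norm.\<close>

lemma exists_functional_nonzero_at:
  fixes v :: "'a::real_normed_vector"
  assumes "v \<noteq> 0"
  shows "\<exists>f::'a \<Rightarrow> real. bounded_linear f \<and> f v \<noteq> 0"
proof -
  have "sublinear (norm :: 'a \<Rightarrow> real)"
    by (simp add: sublinear_def norm_triangle_ineq)
  then obtain q :: "'a \<Rightarrow> real" where q: "sublinear q" "q \<le> norm" "q (- v) \<le> - norm v"
    using sublinear_decrease by blast
  obtain f where f: "sublinear f" "f \<le> q" "\<And>r. sublinear r \<Longrightarrow> r \<le> f \<Longrightarrow> r = f"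
    using exists_minimal_sublinear[OF q(1)] by blast
  have lin: "linear f" using f by (intro minimal_sublinear_imp_linear)
  have le: "f x \<le> norm x" for x
    using f(2) q(2) by (meson le_funD order_trans)
  have "bounded_linear f"
  proof (rule bounded_linear_intro)
    show "norm (f x) \<le> norm x * 1" for x
      using le[of x] le[of "- x"] linear_neg[OF lin, of x] by (simp add: abs_le_iff)
  qed (simp_all add: linear_add[OF lin] linear_scale[OF lin])
  moreover have "f (- v) \<le> - norm v"
    using le_funD[OF f(2), of "- v"] q(3) by linarith
  then have "f v \<noteq> 0"
    using assms linear_neg[OF lin, of v] by auto
  ultimately show ?thesis by blast
qed

section \<open>Ideals and Cauchy sequences\<close>

lemma ideal_on_subset: "ideal_on S I \<Longrightarrow> A \<in> I \<Longrightarrow> B \<subseteq> A \<Longrightarrow> B \<in> I"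
  unfolding ideal_on_def by blast

lemma ideal_on_Un: "ideal_on S I \<Longrightarrow> A \<in> I \<Longrightarrow> B \<in> I \<Longrightarrow> A \<union> B \<in> I"
  unfolding ideal_on_def by blast

lemma ideal_on_UN_finite:
  assumes I: "ideal_on S I" and "finite F" "\<And>n. n \<in> F \<Longrightarrow> A n \<in> I"
  shows "(\<Union>n\<in>F. A n) \<in> I"
  using assms(2,3)
proof (induction rule: finite_induct)
  case empty
  then show ?case using I by (simp add: ideal_on_def)
next
  case (insert n F)
  then show ?case using ideal_on_Un[OF I] by simp
qed

lemma ideal_trace_subset: "ideal_on S K \<Longrightarrow> ideal_trace K M \<subseteq> K"
  by (auto simp: ideal_trace_def intro: ideal_on_subset)

text \<open>The reference index has to be a point where the sequence is small. For proper \<open>I\<close> it exists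
  because the exceptional set is not everything; an improper \<open>I\<close> accepts any index.\<close>

lemma weak_I_Cauchy_if_small_off_ideal:
  fixes x :: "nat \<Rightarrow> 'a::real_normed_vector"
  assumes I: "ideal_on posnat I"
    and small: "\<And>\<epsilon> f::'a \<Rightarrow> real. \<epsilon> > 0 \<Longrightarrow> bounded_linear f \<Longrightarrow> {k\<in>posnat. \<bar>f (x k)\<bar> \<ge> \<epsilon>} \<in> I"
  shows "weak_I_Cauchy I x"
  unfolding weak_I_Cauchy_def weak_Cauchy_on_def
proof (intro allI impI)
  fix \<epsilon> :: real and f :: "'a \<Rightarrow> real"
  assume "\<epsilon> > 0" and f: "bounded_linear f"
  let ?E = "{k\<in>posnat. \<bar>f (x k)\<bar> \<ge> \<epsilon> / 2}"
  have E: "?E \<in> I" using small[OF _ f, of "\<epsilon> / 2"] \<open>\<epsilon> > 0\<close> by simp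
  show "\<exists>N\<in>posnat. {n \<in> posnat. \<bar>f (x n) - f (x N)\<bar> \<ge> \<epsilon>} \<in> I"
  proof (cases "?E = posnat")
    case True
    then have "{n \<in> posnat. \<bar>f (x n) - f (x 1)\<bar> \<ge> \<epsilon>} \<in> I"
      using E by (intro ideal_on_subset[OF I E]) auto
    then show ?thesis by (intro bexI[of _ 1]) auto
  next
    case False
    then obtain N where N: "N \<in> posnat" "\<bar>f (x N)\<bar> < \<epsilon> / 2" by force
    then have "{n \<in> posnat. \<bar>f (x n) - f (x N)\<bar> \<ge> \<epsilon>} \<subseteq> ?E" by auto
    with N show ?thesis using ideal_on_subset[OF I E] by blast
  qed
qed

text \<open>If \<open>f\<close> keeps the sequence on \<open>A\<close> at distance at least \<open>\<epsilon>\<close> from its values off \<open>A\<close>, then the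
  points of \<open>M\<close> on the other side of \<open>A\<close> from the reference index for this \<open>\<epsilon>\<close> are all
  exceptional.\<close>

lemma Cauchy_isolated_value_dichotomy:
  fixes f :: "'a::real_normed_vector \<Rightarrow> real"
  assumes K: "ideal_on S K" and Cauchy: "weak_Cauchy_on M (ideal_trace K M) x"
    and f: "bounded_linear f" and "\<epsilon> > 0"
    and gap: "\<And>j k. j \<in> A \<Longrightarrow> k \<notin> A \<Longrightarrow> \<bar>f (x j) - f (x k)\<bar> \<ge> \<epsilon>"
  shows "M \<inter> A \<in> K \<or> M - A \<in> K"
proof -
  obtain N where "N \<in> M" and E: "{n\<in>M. \<bar>f (x n) - f (x N)\<bar> \<ge> \<epsilon>} \<in> K" (is "?E \<in> K")
    using Cauchy f \<open>\<epsilon> > 0\<close> ideal_trace_subset[OF K, of M]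
    unfolding weak_Cauchy_on_def by blast
  show ?thesis
  proof (cases "N \<in> A")
    case True
    have "M - A \<subseteq> ?E"
      using gap[OF True] by (auto simp: abs_minus_commute)
    then show ?thesis using ideal_on_subset[OF K E] by blast
  next
    case False
    have "M \<inter> A \<subseteq> ?E"
      using gap[OF _ False] by auto
    then show ?thesis using ideal_on_subset[OF K E] by blast
  qed
qed

section \<open>The sequence attached to a disjoint family\<close>

lemma exists_reciprocal_weight:
  assumes disj: "disjoint_family_on A posnat"
  shows "\<exists>w :: nat \<Rightarrow> real. (\<forall>k. \<forall>n\<in>posnat. k \<in> A n \<longrightarrow> w k = 1 / real n) \<and>
           (\<forall>k. k \<notin> (\<Union>n\<in>posnat. A n) \<longrightarrow> w k = 0)"
proof -
  have "\<exists>c::real. (\<forall>n\<in>posnat. k \<in> A n \<longrightarrow> c = 1 / real n) \<and>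
          (k \<notin> (\<Union>n\<in>posnat. A n) \<longrightarrow> c = 0)" for k
  proof (cases "k \<in> (\<Union>n\<in>posnat. A n)")
    case True
    then obtain n where n: "n \<in> posnat" "k \<in> A n" by blast
    have "m = n" if "m \<in> posnat" "k \<in> A m" for m
      using disjoint_family_onD[OF disj that(1) n(1)] that(2) n(2) by blast
    then have "(\<forall>m\<in>posnat. k \<in> A m \<longrightarrow> 1 / real n = 1 / real m) \<and>
        (k \<notin> (\<Union>m\<in>posnat. A m) \<longrightarrow> 1 / real n = 0)"
      using True by blast
    then show ?thesis by (rule exI)
  next
    case False
    then have "(\<forall>n\<in>posnat. k \<in> A n \<longrightarrow> 0 = 1 / real n) \<and>
        (k \<notin> (\<Union>n\<in>posnat. A n) \<longrightarrow> (0::real) = 0)"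
      by blast
    then show ?thesis by (rule exI)
  qed
  then obtain w :: "nat \<Rightarrow> real" where "\<forall>k. (\<forall>n\<in>posnat. k \<in> A n \<longrightarrow> w k = 1 / real n) \<and>
      (k \<notin> (\<Union>n\<in>posnat. A n) \<longrightarrow> w k = 0)"
    by (rule choice[OF allI, THEN exE])
  then show ?thesis by blast
qed

lemma reciprocal_gap:
  fixes m n :: nat
  assumes "m \<ge> 1" "n \<ge> 1" "m \<noteq> n"
  shows "\<bar>1 / real n - 1 / real m\<bar> \<ge> 1 / (real n * real (n + 1))"
proof (cases "n < m")
  case True
  then have "1 / real m \<le> 1 / real (n + 1)"
    using assms by (intro divide_left_mono) auto
  moreover have "1 / real n - 1 / real (n + 1) = 1 / (real n * real (n + 1))"
    using assms by (simp add: field_simps)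
  ultimately show ?thesis by linarith
next
  case False
  then have "m < n" using assms by simp
  then have "1 \<le> real n - real m" by linarith
  moreover have "real m * real n \<le> real n * real (n + 1)"
    using \<open>m < n\<close> by (simp add: mult.commute)
  ultimately have "1 / (real n * real (n + 1)) \<le> (real n - real m) / (real m * real n)"
    using assms by (intro frac_le) simp_all
  also have "\<dots> = 1 / real m - 1 / real n"
    using assms by (simp add: diff_divide_distrib)
  finally show ?thesis by linarith
qed

theorem theorem3p3:
  fixes I K :: "nat set set"
  assumes "ideal_on posnat I" and "ideal_on posnat K"
    and "\<exists>v::'a::real_normed_vector. v \<noteq> 0"
    and "\<And>x :: nat \<Rightarrow> 'a. weak_I_Cauchy I x \<Longrightarrow> weak_IK_Cauchy I K x"
  shows "AP I K"
  unfolding AP_def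
proof (intro allI impI, elim conjE)
  note I = assms(1) and K = assms(2)
  fix A :: "nat \<Rightarrow> nat set"
  assume "\<forall>n\<in>posnat. A n \<in> I" and disj: "disjoint_family_on A posnat"
  then have AI: "A n \<in> I" if "n \<in> posnat" for n using that by blast
  obtain v :: 'a where "v \<noteq> 0" using assms(3) by blast
  then obtain f :: "'a \<Rightarrow> real" where f: "bounded_linear f" and fv: "f v \<noteq> 0"
    using exists_functional_nonzero_at by blast
  obtain w where w: "\<And>k n. n \<in> posnat \<Longrightarrow> k \<in> A n \<Longrightarrow> w k = 1 / real n"
    and w0: "\<And>k. k \<notin> (\<Union>n\<in>posnat. A n) \<Longrightarrow> w k = 0"
    using exists_reciprocal_weight[OF disj] by metis
  define x where "x k = w k *\<^sub>R v" for k
  have gx: "g (x k) = w k * g v" if "bounded_linear g" for g :: "'a \<Rightarrow> real" and k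
    using linear_scale[OF bounded_linear.linear[OF that]] by (simp add: x_def)

  have "weak_I_Cauchy I x"
  proof (rule weak_I_Cauchy_if_small_off_ideal[OF I])
    fix \<epsilon> :: real and g :: "'a \<Rightarrow> real"
    assume "\<epsilon> > 0" and g: "bounded_linear g"
    obtain L :: nat where L: "\<bar>g v\<bar> / \<epsilon> < real L" using reals_Archimedean2 by blast
    have "{k\<in>posnat. \<bar>g (x k)\<bar> \<ge> \<epsilon>} \<subseteq> (\<Union>n\<in>{1..L}. A n)"
    proof
      fix k assume "k \<in> {k\<in>posnat. \<bar>g (x k)\<bar> \<ge> \<epsilon>}"
      then have k: "\<epsilon> \<le> \<bar>w k * g v\<bar>" by (simp add: gx[OF g])
      then have "w k \<noteq> 0" using \<open>\<epsilon> > 0\<close> by auto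
      then obtain n where n: "n \<in> posnat" "k \<in> A n" using w0 by blast
      then have "\<epsilon> \<le> \<bar>g v\<bar> / real n" using k w by (simp add: abs_mult)
      then have "real n \<le> \<bar>g v\<bar> / \<epsilon>" using n \<open>\<epsilon> > 0\<close> by (simp add: field_simps)
      then have "n \<le> L" using L by linarith
      then show "k \<in> (\<Union>n\<in>{1..L}. A n)" using n by auto
    qed
    moreover have "(\<Union>n\<in>{1..L}. A n) \<in> I"
      using AI by (intro ideal_on_UN_finite[OF I]) auto
    ultimately show "{k\<in>posnat. \<bar>g (x k)\<bar> \<ge> \<epsilon>} \<in> I" using ideal_on_subset[OF I] by blast
  qed
  then have "weak_IK_Cauchy I K x" by (rule assms(4))
  then obtain M where M: "posnat - M \<in> I"
    and Cauchy: "weak_Cauchy_on M (ideal_trace K M) x"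
    unfolding weak_IK_Cauchy_def dual_filter_def by blast

  have dichotomy: "M \<inter> A n \<in> K \<or> M - A n \<in> K" if n: "n \<in> posnat" for n
  proof (rule Cauchy_isolated_value_dichotomy[OF K Cauchy f])
    let ?\<delta> = "1 / (real n * real (n + 1))"
    show "?\<delta> * \<bar>f v\<bar> > 0" using n fv by simp
    fix j k assume "j \<in> A n" "k \<notin> A n"
    have "\<bar>1 / real n - w k\<bar> \<ge> ?\<delta>"
    proof (cases "k \<in> (\<Union>n\<in>posnat. A n)")
      case True
      then obtain m where "m \<in> posnat" "k \<in> A m" by blast
      then show ?thesis using w[of m k] reciprocal_gap[of m n] n \<open>k \<notin> A n\<close> by fastforce
    next
      case False
      have "?\<delta> \<le> 1 / real n" using n by (intro frac_le) simp_all
      then show ?thesis using w0[OF False] by simp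
    qed
    then have "?\<delta> * \<bar>f v\<bar> \<le> \<bar>1 / real n - w k\<bar> * \<bar>f v\<bar>" by (rule mult_right_mono) simp
    also have "\<dots> = \<bar>f (x j) - f (x k)\<bar>"
      using w[OF n \<open>j \<in> A n\<close>] by (simp add: gx[OF f] left_diff_distrib flip: abs_mult)
    finally show "?\<delta> * \<bar>f v\<bar> \<le> \<bar>f (x j) - f (x k)\<bar>" .
  qed

  \<comment> \<open>\<open>D\<close> is the single exceptional set \<open>A m\<close>, or empty if there is none.\<close>
  obtain D where D: "D \<in> I" "\<And>n. n \<in> posnat \<Longrightarrow> A n \<subseteq> D \<or> (A n \<inter> D = {} \<and> M \<inter> A n \<in> K)"
  proof (cases "\<exists>m\<in>posnat. M - A m \<in> K")
    case True
    then obtain m where m: "m \<in> posnat" "M - A m \<in> K" by blast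
    show ?thesis
    proof (rule that[of "A m"])
      show "A n \<subseteq> A m \<or> (A n \<inter> A m = {} \<and> M \<inter> A n \<in> K)" if "n \<in> posnat" for n
      proof (cases "n = m")
        case False
        then have "A n \<inter> A m = {}" using disj that m by (meson disjoint_family_onD)
        moreover from this have "M \<inter> A n \<in> K" by (intro ideal_on_subset[OF K m(2)]) auto
        ultimately show ?thesis by blast
      qed simp
    qed (rule AI[OF m(1)])
  next
    case False
    then show ?thesis
      using dichotomy I by (intro that[of "{}"]) (auto simp: ideal_on_def)
  qed
  define B where "B n = A n \<inter> ((posnat - M) \<union> D)" for n
  have "B n \<in> I \<and> (A n - B n) \<union> (B n - A n) \<in> K" if n: "n \<in> posnat" for n
  proof
    show "B n \<in> I" using AI[OF n] by (rule ideal_on_subset[OF I]) (auto simp: B_def)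
    have "A n \<subseteq> posnat" using AI[OF n] I by (auto simp: ideal_on_def)
    show "(A n - B n) \<union> (B n - A n) \<in> K"
      using D(2)[OF n]
    proof
      assume "A n \<subseteq> D"
      then have "B n = A n" by (auto simp: B_def)
      then show ?thesis using K by (simp add: ideal_on_def)
    next
      assume "A n \<inter> D = {} \<and> M \<inter> A n \<in> K"
      moreover have "(A n - B n) \<union> (B n - A n) \<subseteq> M \<inter> A n"
        using \<open>A n \<subseteq> posnat\<close> by (auto simp: B_def)
      ultimately show ?thesis using ideal_on_subset[OF K] by blast
    qed
  qed
  moreover have "(\<Union>n\<in>posnat. B n) \<in> I"
    using ideal_on_Un[OF I M D(1)] by (rule ideal_on_subset[OF I]) (auto simp: B_def)
  ultimately show "\<exists>B. (\<forall>n\<in>posnat. B n \<in> I \<and> (A n - B n) \<union> (B n - A n) \<in> K) \<and>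
      (\<Union>n\<in>posnat. B n) \<in> I"
    by blast
qed

end
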